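(* Consider the augmented optimization problems $A(t,\zeta)$ defined in the context, built from a forward separable problem with associated functions $\phi_{t_0},\dots,\phi_T$. They satisfy the principle of optimality and the Bellman equation, that is: (i) for any $s,t$ with $t_0\le t<s\le T$, if $(u(t),\dots,u(T-1))$ and $(z(t),\dots,z(T+1))$ solve $A(t,z(t))$, then $(u(s),\dots,u(T-1))$ and $(z(s),\dots,z(T+1))$ solve $A(s,z(s))$; (ii) if $F(\zeta,t)$ denotes the optimal value of $A(t,\zeta)$ for $t\in\{t_0,\dots,T\}$ and $\zeta=(\zeta_1,\zeta_2)\in X\times\mathbb{R}^q$, then $F(\zeta,T)=\phi_T(\zeta_1,\zeta_2)$ and, for all $\zeta\in X\times\mathbb{R}^q$ and $t\in\{t_0,\dots,T-1\}$, $$F(\zeta,t)=\inf_{u\in\Gamma_{t,\zeta_1}}F(g_t(\zeta,u),t+1).$$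
   Context: Data: $T\in\mathbb{N}$, $t_0\in\{0,\dots,T-1\}$, $X\subset\mathbb{R}^n$, $U\subset\mathbb{R}^p$, $f:\mathbb{R}^n\times\mathbb{R}^p\times\mathbb{N}\to\mathbb{R}^n$, $q\in\mathbb{N}$, and functions $\phi_{t_0}:\mathbb{R}^n\times\mathbb{R}^p\to\mathbb{R}^q$, $\phi_t:\mathbb{R}^n\times\mathbb{R}^p\times\mathbb{R}^q\to\mathbb{R}^q$ for $t_0<t<T$, $\phi_T:\mathbb{R}^n\times\mathbb{R}^q\to\mathbb{R}$. These functions represent a forward separable objective $J_{t_0,x_0}(\mathbf{u},\mathbf{x})=\phi_T(x(T),\phi_{T-1}[x(T-1),u(T-1),\dots,\phi_{t_0+1}\{x(t_0+1),u(t_0+1),\phi_{t_0}\{x(t_0),u(t_0)\}\}\dots])$. For $\zeta=(\zeta_1,\zeta_2)\in\mathbb{R}^n\times\mathbb{R}^q$ and $u\in\mathbb{R}^p$ set $g_{t_0}(\zeta,u)=(f[\zeta_1,u,t_0],\phi_{t_0}(\zeta_1,u))$ and $g_t(\zeta,u)=(f[\zeta_1,u,t],\phi_t(\zeta_1,u,\zeta_2))$ for $t_0<t<T$. For $t\in\{t_0,\dots,T\}$, $A(t,\zeta)$ is the problem of minimizing $z_2(T+1)$ over $(u(t),\dots,u(T-1))$ and $(z(t),\dots,z(T+1))$, $z(k)=(z_1(k),z_2(k))$, subject to $z(t)=\zeta$; $z(k+1)=g_k(z(k),u(k))$ for $k=t,\dots,T-1$; $z_1(T+1)=z_1(T)$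 and $z_2(T+1)=\phi_T(z_1(T),z_2(T))\in\mathbb{R}$; $z_1(k)\in X$ for $k=t+1,\dots,T$; $u(k)\in U$ for $k=t,\dots,T-1$. (For $t=T$ there are no inputs.) The augmented problem associated with initial state $x_0$ at time $t_0$ is $A(t_0,(x_0,0))$. A pair solves a problem if it is feasible and attains the minimum of the objective over feasible pairs; the optimal value is the objective value at a solution. For $x\in X$, $\Gamma_{t,x}=\{u\in U: f[x,u,t]\in X\}$. Standing assumptions: $\Gamma_{t,x}$ is nonempty for all $x\in X$ and all $t$, and, for part (ii), every $A(t,\zeta)$ with $\zeta\in X\times\mathbb{R}^q$ has a solution. *)

theory Defs
  imports "HOL-Analysis.Analysis"
begin

text \<open>The type arguments \<open>'n\<close>, \<open>'p\<close>, \<open>'q\<close> index the coordinates of the state, the input and the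
  accumulated cost. \<open>phi P t\<close> is only meaningful for \<open>start P < t < horizon P\<close>.\<close>

record ('n::finite, 'p::finite, 'q::finite) forward_problem =
  horizon :: nat
  start :: nat
  states :: "(real ^ 'n) set"
  inputs :: "(real ^ 'p) set"
  dyn :: "real ^ 'n \<Rightarrow> real ^ 'p \<Rightarrow> nat \<Rightarrow> real ^ 'n"
  phi_start :: "real ^ 'n \<Rightarrow> real ^ 'p \<Rightarrow> real ^ 'q"
  phi :: "nat \<Rightarrow> real ^ 'n \<Rightarrow> real ^ 'p \<Rightarrow> real ^ 'q \<Rightarrow> real ^ 'q"
  phi_final :: "real ^ 'n \<Rightarrow> real ^ 'q \<Rightarrow> real"

text \<open>\<open>nested_value P u x j\<close> is the nested expression up to and including stage \<open>start P + j\<close>.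
  Finite sequences indexed by \<open>a, \<dots>, b\<close> are encoded throughout as functions on \<^typ>\<open>nat\<close> whose values
  at other indices are irrelevant.\<close>

primrec nested_value ::
  "('n::finite, 'p::finite, 'q::finite) forward_problem \<Rightarrow> (nat \<Rightarrow> real ^ 'p) \<Rightarrow> (nat \<Rightarrow> real ^ 'n) \<Rightarrow> nat \<Rightarrow> real ^ 'q" where
  "nested_value P u x 0 = phi_start P (x (start P)) (u (start P))"
| "nested_value P u x (Suc j) =
     phi P (start P + Suc j) (x (start P + Suc j)) (u (start P + Suc j)) (nested_value P u x j)"

definition forward_objective ::
  "('n::finite, 'p::finite, 'q::finite) forward_problem \<Rightarrow> (nat \<Rightarrow> real ^ 'p) \<Rightarrow> (nat \<Rightarrow> real ^ 'n) \<Rightarrow> real" where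
  "forward_objective P u x =
     phi_final P (x (horizon P)) (nested_value P u x (horizon P - 1 - start P))"

definition aug_dyn ::
  "('n::finite, 'p::finite, 'q::finite) forward_problem \<Rightarrow> nat \<Rightarrow> (real ^ 'n) \<times> (real ^ 'q) \<Rightarrow> real ^ 'p \<Rightarrow> (real ^ 'n) \<times> (real ^ 'q)" where
  "aug_dyn P t \<zeta> u =
     (dyn P (fst \<zeta>) u t,
      if t = start P then phi_start P (fst \<zeta>) u else phi P t (fst \<zeta>) u (snd \<zeta>))"

text \<open>The last augmented state, at time \<open>horizon P + 1\<close>, has a scalar second component, so it is the
  separate argument \<open>w\<close>; the objective to be minimized is \<open>snd w\<close>.\<close>

definition feasible ::
  "('n::finite, 'p::finite, 'q::finite) forward_problem \<Rightarrow> nat \<Rightarrow> (real ^ 'n) \<times> (real ^ 'q) \<Rightarrow>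
   (nat \<Rightarrow> real ^ 'p) \<Rightarrow> (nat \<Rightarrow> (real ^ 'n) \<times> (real ^ 'q)) \<Rightarrow> (real ^ 'n) \<times> real \<Rightarrow> bool" where
  "feasible P t \<zeta> u z w \<longleftrightarrow>
     z t = \<zeta> \<and>
     (\<forall>k\<in>{t..<horizon P}. z (k + 1) = aug_dyn P k (z k) (u k)) \<and>
     fst w = fst (z (horizon P)) \<and>
     snd w = phi_final P (fst (z (horizon P))) (snd (z (horizon P))) \<and>
     (\<forall>k\<in>{t + 1..horizon P}. fst (z k) \<in> states P) \<and>
     (\<forall>k\<in>{t..<horizon P}. u k \<in> inputs P)"

definition solves ::
  "('n::finite, 'p::finite, 'q::finite) forward_problem \<Rightarrow> nat \<Rightarrow> (real ^ 'n) \<times> (real ^ 'q) \<Rightarrow>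
   (nat \<Rightarrow> real ^ 'p) \<Rightarrow> (nat \<Rightarrow> (real ^ 'n) \<times> (real ^ 'q)) \<Rightarrow> (real ^ 'n) \<times> real \<Rightarrow> bool" where
  "solves P t \<zeta> u z w \<longleftrightarrow>
     feasible P t \<zeta> u z w \<and> (\<forall>u' z' w'. feasible P t \<zeta> u' z' w' \<longrightarrow> snd w \<le> snd w')"

text \<open>Only meaningful when a solution exists; all solutions then have the same objective value.\<close>

definition optimal_value :: "('n::finite, 'p::finite, 'q::finite) forward_problem \<Rightarrow> (real ^ 'n) \<times> (real ^ 'q) \<Rightarrow> nat \<Rightarrow> real" where
  "optimal_value P \<zeta> t = (THE v. \<exists>u z w. solves P t \<zeta> u z w \<and> v = snd w)"

definition admissible_inputs :: "('n::finite, 'p::finite, 'q::finite) forward_problem \<Rightarrow> nat \<Rightarrow> real ^ 'n \<Rightarrow> (real ^ 'p) set" where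
  "admissible_inputs P t x = {u \<in> inputs P. dyn P x u t \<in> states P}"

end

theory Submission
  imports Defs
begin

text \<open>
  Everything follows from one recursion (\<open>feasible_step_iff\<close>): before the horizon, a trajectory is
  feasible from \<open>\<zeta>\<close> at time \<open>t\<close> exactly when its first input is admissible and its remainder is feasible from the successor
  state at time \<open>t + 1\<close>. This uses that \<open>aug_dyn\<close> is a Markovian transition: the second component of
  the augmented state carries all that the past contributes to the objective, and the objective is
  read off at the terminal state only. Hence prepending an admissible first step to a feasible
  tail (\<open>feasible_prepend\<close>), or dropping the first step, does not change the objective value.

  For the principle of optimality, a better tail from \<open>z (t + 1)\<close> would give, after prepending the first
  step, a better trajectory from \<open>z t\<close>; so optimality is passed on by one time step (\<open>solves_step\<close>), and by
  induction to every later time. For the Bellman equation, prepending an admissible input to an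
  optimal tail shows that \<open>F (\<zeta>, t)\<close> is a lower bound for the values \<open>F (g\<^sub>t (\<zeta>, v), t + 1)\<close>, and the
  principle of optimality shows that the first input of an optimal trajectory attains this
  bound (\<open>bellman_equation\<close>).
\<close>

lemma feasible_cong:
  assumes "feasible P t \<zeta> u z w" and "t \<le> horizon P"
    and "\<And>k. t \<le> k \<Longrightarrow> u' k = u k" and "\<And>k. t \<le> k \<Longrightarrow> z' k = z k"
  shows "feasible P t \<zeta> u' z' w"
  using assms by (auto simp: feasible_def)

text \<open>The state constraint at time \<open>t + 1\<close>, which the tail problem does not impose on its own initial
  state, becomes the membership of the first input in the admissible set.\<close>

lemma feasible_step_iff:
  assumes "t < horizon P"
  shows "feasible P t \<zeta> u z w \<longleftrightarrow>
    z t = \<zeta> \<and> u t \<in> admissible_inputs P t (fst \<zeta>) \<and> feasible P (t + 1) (aug_dyn P t \<zeta> (u t)) u z w"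
proof -
  have "{t..<horizon P} = insert t {t + 1..<horizon P}"
    and "{t + 1..horizon P} = insert (t + 1) {t + 1 + 1..horizon P}"
    using assms by auto
  then show ?thesis
    unfolding feasible_def admissible_inputs_def by (auto simp: aug_dyn_def)
qed

lemma feasible_prepend:
  assumes "t < horizon P" and "v \<in> admissible_inputs P t (fst \<zeta>)"
    and "feasible P (t + 1) (aug_dyn P t \<zeta> v) u z w"
  shows "feasible P t \<zeta> (u(t := v)) (z(t := \<zeta>)) w"
proof -
  have "feasible P (t + 1) (aug_dyn P t \<zeta> v) (u(t := v)) (z(t := \<zeta>)) w"
    using assms(1) by (intro feasible_cong[OF assms(3)]) auto
  then show ?thesis
    using assms(1,2) by (simp add: feasible_step_iff)
qed

lemma feasible_successor:
  assumes "feasible P t \<zeta> u z w" and "t < horizon P"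
  shows "z (t + 1) = aug_dyn P t \<zeta> (u t)"
  using assms by (auto simp: feasible_def)

lemma solves_step:
  assumes "solves P t \<zeta> u z w" and "t < horizon P"
  shows "solves P (t + 1) (z (t + 1)) u z w"
  unfolding solves_def
proof (intro conjI allI impI)
  have feas: "feasible P t \<zeta> u z w"
    and opt: "\<And>u' z' w'. feasible P t \<zeta> u' z' w' \<Longrightarrow> snd w \<le> snd w'"
    using assms(1) by (auto simp: solves_def)
  note succ = feasible_successor[OF feas assms(2)]
  have adm: "u t \<in> admissible_inputs P t (fst \<zeta>)"
    using feas assms(2) by (simp add: feasible_step_iff)
  show "feasible P (t + 1) (z (t + 1)) u z w"
    using feas assms(2) succ by (simp add: feasible_step_iff)
  fix u' z' w'
  assume "feasible P (t + 1) (z (t + 1)) u' z' w'"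
  then have "feasible P t \<zeta> (u'(t := u t)) (z'(t := \<zeta>)) w'"
    using succ by (intro feasible_prepend assms(2) adm) simp
  then show "snd w \<le> snd w'"
    by (rule opt)
qed

lemma principle_of_optimality:
  assumes "t \<le> s" and "s \<le> horizon P" and "solves P t (z t) u z w"
  shows "solves P s (z s) u z w"
  using assms
proof (induction s rule: dec_induct)
  case base
  then show ?case by simp
next
  case (step k)
  then show ?case
    using solves_step[of P k "z k" u z w] by simp
qed

lemma optimal_value_eq:
  assumes "solves P t \<zeta> u z w"
  shows "optimal_value P \<zeta> t = snd w"
  unfolding optimal_value_def
proof (rule the_equality)
  show "\<exists>u' z' w'. solves P t \<zeta> u' z' w' \<and> snd w = snd w'"
    using assms by blast
  fix v
  assume "\<exists>u z w. solves P t \<zeta> u z w \<and> v = snd w"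
  then obtain u' z' w' where "solves P t \<zeta> u' z' w'" and "v = snd w'"
    by blast
  with assms show "v = snd w"
    unfolding solves_def by (blast intro: order.antisym)
qed

lemma optimal_value_horizon:
  assumes "solves P (horizon P) \<zeta> u z w"
  shows "optimal_value P \<zeta> (horizon P) = phi_final P (fst \<zeta>) (snd \<zeta>)"
  using optimal_value_eq[OF assms] assms by (auto simp: solves_def feasible_def)

text \<open>The infimum is a minimum, attained at the first input of any solution from \<open>\<zeta>\<close>. Solutions of the
  tail problems are needed because \<open>optimal_value\<close> is meaningful only where one exists.\<close>

lemma bellman_equation:
  assumes "t < horizon P" and sol: "solves P t \<zeta> u z w"
    and tails: "\<And>v. v \<in> admissible_inputs P t (fst \<zeta>) \<Longrightarrow>
      \<exists>u z w. solves P (t + 1) (aug_dyn P t \<zeta> v) u z w"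
  shows "ereal (optimal_value P \<zeta> t) =
    (INF v\<in>admissible_inputs P t (fst \<zeta>). ereal (optimal_value P (aug_dyn P t \<zeta> v) (t + 1)))"
proof (rule antisym)
  have feas: "feasible P t \<zeta> u z w"
    using sol by (simp add: solves_def)
  show "ereal (optimal_value P \<zeta> t) \<le>
    (INF v\<in>admissible_inputs P t (fst \<zeta>). ereal (optimal_value P (aug_dyn P t \<zeta> v) (t + 1)))"
  proof (rule INF_greatest)
    fix v
    assume v: "v \<in> admissible_inputs P t (fst \<zeta>)"
    then obtain u' z' w' where tail: "solves P (t + 1) (aug_dyn P t \<zeta> v) u' z' w'"
      using tails by blast
    then have "feasible P t \<zeta> (u'(t := v)) (z'(t := \<zeta>)) w'"
      by (intro feasible_prepend assms(1) v) (simp add: solves_def)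
    then have "snd w \<le> snd w'"
      using sol unfolding solves_def by blast
    then show "ereal (optimal_value P \<zeta> t) \<le> ereal (optimal_value P (aug_dyn P t \<zeta> v) (t + 1))"
      using optimal_value_eq[OF sol] optimal_value_eq[OF tail] by simp
  qed
  have "u t \<in> admissible_inputs P t (fst \<zeta>)"
    using feas assms(1) by (simp add: feasible_step_iff)
  then have "(INF v\<in>admissible_inputs P t (fst \<zeta>). ereal (optimal_value P (aug_dyn P t \<zeta> v) (t + 1)))
      \<le> ereal (optimal_value P (aug_dyn P t \<zeta> (u t)) (t + 1))"
    by (rule INF_lower)
  also have "optimal_value P (aug_dyn P t \<zeta> (u t)) (t + 1) = optimal_value P \<zeta> t"
    using optimal_value_eq[OF sol] optimal_value_eq[OF solves_step[OF sol assms(1)]]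
      feasible_successor[OF feas assms(1)] by simp
  finally show "(INF v\<in>admissible_inputs P t (fst \<zeta>).
      ereal (optimal_value P (aug_dyn P t \<zeta> v) (t + 1))) \<le> ereal (optimal_value P \<zeta> t)" .
qed

theorem proposition2:
  fixes P :: "('n::finite, 'p::finite, 'q::finite) forward_problem"
    and J :: "(nat \<Rightarrow> real ^ 'p) \<Rightarrow> (nat \<Rightarrow> real ^ 'n) \<Rightarrow> real"
  assumes "start P < horizon P"
    and "\<forall>u x. J u x = forward_objective P u x"
    and "\<forall>t\<in>{start P..<horizon P}. \<forall>x\<in>states P. admissible_inputs P t x \<noteq> {}"
  shows "(\<forall>s t u z w. start P \<le> t \<and> t < s \<and> s \<le> horizon P \<and> solves P t (z t) u z w
            \<longrightarrow> solves P s (z s) u z w) \<and>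
         ((\<forall>t\<in>{start P..horizon P}. \<forall>\<zeta>\<in>states P \<times> UNIV. \<exists>u z w. solves P t \<zeta> u z w) \<longrightarrow>
            (\<forall>\<zeta>\<in>states P \<times> UNIV.
               optimal_value P \<zeta> (horizon P) = phi_final P (fst \<zeta>) (snd \<zeta>)) \<and>
            (\<forall>\<zeta>\<in>states P \<times> UNIV. \<forall>t\<in>{start P..<horizon P}.
               ereal (optimal_value P \<zeta> t) =
                 (INF u\<in>admissible_inputs P t (fst \<zeta>).
                    ereal (optimal_value P (aug_dyn P t \<zeta> u) (t + 1)))))"
proof (intro conjI impI)
  show "\<forall>s t u z w. start P \<le> t \<and> t < s \<and> s \<le> horizon P \<and> solves P t (z t) u z w
    \<longrightarrow> solves P s (z s) u z w"
    by (blast intro: principle_of_optimality less_imp_le)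
next
  assume "\<forall>t\<in>{start P..horizon P}. \<forall>\<zeta>\<in>states P \<times> UNIV. \<exists>u z w. solves P t \<zeta> u z w"
  then have ex: "\<exists>u z w. solves P t \<zeta> u z w"
    if "start P \<le> t" "t \<le> horizon P" "fst \<zeta> \<in> states P" for t \<zeta>
    using that by (cases \<zeta>) auto
  show "\<forall>\<zeta>\<in>states P \<times> UNIV. optimal_value P \<zeta> (horizon P) = phi_final P (fst \<zeta>) (snd \<zeta>)"
  proof
    fix \<zeta> :: "(real ^ 'n) \<times> (real ^ 'q)"
    assume "\<zeta> \<in> states P \<times> UNIV"
    then obtain u z w where "solves P (horizon P) \<zeta> u z w"
      using ex[of "horizon P" \<zeta>] assms(1) by auto
    then show "optimal_value P \<zeta> (horizon P) = phi_final P (fst \<zeta>) (snd \<zeta>)"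
      by (rule optimal_value_horizon)
  qed
  show "\<forall>\<zeta>\<in>states P \<times> UNIV. \<forall>t\<in>{start P..<horizon P}.
      ereal (optimal_value P \<zeta> t) =
        (INF u\<in>admissible_inputs P t (fst \<zeta>).
           ereal (optimal_value P (aug_dyn P t \<zeta> u) (t + 1)))"
  proof (intro ballI)
    fix \<zeta> :: "(real ^ 'n) \<times> (real ^ 'q)" and t
    assume \<zeta>: "\<zeta> \<in> states P \<times> UNIV" and t: "t \<in> {start P..<horizon P}"
    then obtain u z w where sol: "solves P t \<zeta> u z w"
      using ex[of t \<zeta>] by auto
    show "ereal (optimal_value P \<zeta> t) =
      (INF u\<in>admissible_inputs P t (fst \<zeta>). ereal (optimal_value P (aug_dyn P t \<zeta> u) (t + 1)))"
    proof (rule bellman_equation[OF _ sol])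
      show "t < horizon P"
        using t by simp
      fix v
      assume "v \<in> admissible_inputs P t (fst \<zeta>)"
      then have "fst (aug_dyn P t \<zeta> v) \<in> states P"
        by (simp add: admissible_inputs_def aug_dyn_def)
      then show "\<exists>u z w. solves P (t + 1) (aug_dyn P t \<zeta> v) u z w"
        using t by (intro ex) auto
    qed
  qed
qed

end
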